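(* Let $\theta$ be a complex Pisot number with $1<|\theta|<\sqrt2$, and let $\lambda=1/\theta$. Then the measure $\nu_\lambda$ is singular with respect to two-dimensional Lebesgue measure $\mathcal L_2$.
   Context: A non-real algebraic integer $\theta$ with $|\theta|>1$ is a complex Pisot number if all its Galois conjugates other than $\overline\theta$ have modulus less than one. For $\lambda\in\mathbb C$, $|\lambda|<1$, $\nu_\lambda$ is the distribution of the random series $\sum_{n\ge0}\pm\lambda^n$ with signs chosen independently, each with probability $1/2$; equivalently the unique Borel probability measure on $\mathbb C$ with $\nu_\lambda=\frac12(\nu_\lambda\circ S_1^{-1}+\nu_\lambda\circ S_2^{-1})$, $S_1(z)=\lambda z+1$, $S_2(z)=\lambda z-1$. *)

theory Defs
  imports "HOL-Probability.Probability" "HOL-Computational_Algebra.Polynomial"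
    "HOL-Computational_Algebra.Polynomial_Factorial"
begin

text \<open>Galois conjugates of an algebraic integer theta: the complex roots of the
  (unique) monic irreducible integer polynomial vanishing at theta (its minimal polynomial).\<close>

definition complex_pisot :: "complex \<Rightarrow> bool" where
  "complex_pisot \<theta> \<longleftrightarrow>
     \<theta> \<notin> \<real> \<and> norm \<theta> > 1 \<and>
     (\<exists>p :: int poly. lead_coeff p = 1 \<and> irreducible p \<and>
        poly (map_poly of_int p) \<theta> = 0 \<and>
        (\<forall>z. poly (map_poly of_int p) z = 0 \<and> z \<noteq> \<theta> \<and> z \<noteq> cnj \<theta> \<longrightarrow> norm z < 1))"

definition sign_space :: "(nat \<Rightarrow> complex) measure" where
  "sign_space = PiM UNIV (\<lambda>_. measure_pmf (pmf_of_set {-1, 1}))"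

definition bernoulli_conv :: "complex \<Rightarrow> complex measure" where
  "bernoulli_conv l = distr sign_space borel (\<lambda>\<omega>. \<Sum>n. \<omega> n * l ^ n)"

definition singular_wrt_lebesgue :: "complex measure \<Rightarrow> bool" where
  "singular_wrt_lebesgue \<mu> \<longleftrightarrow>
     (\<exists>A \<in> sets borel. emeasure lborel A = 0 \<and> emeasure \<mu> (UNIV - A) = 0)"

end

theory Submission
  imports Defs "Jordan_Normal_Form.Char_Poly"
begin

text \<open>
  Write \<open>\<lambda> = 1 / \<theta>\<close>. The Fourier transform of \<open>\<nu>\<^sub>\<lambda>\<close> at \<open>w\<close> is the product of the
  \<open>cos (Re (w \<lambda>\<^sup>k))\<close>. For \<open>w = 2 \<pi> \<theta>\<^sup>N\<close> the factors are \<open>cos (2 \<pi> Re \<theta>\<^sup>j)\<close> with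
  \<open>j \<le> N\<close>. Since the trace of \<open>\<theta>\<^sup>j\<close> is an integer, \<open>2 Re \<theta>\<^sup>j\<close> is exponentially close to
  an integer for \<open>j \<rightarrow> \<infinity>\<close>, and it tends to 0 exponentially for \<open>j \<rightarrow> -\<infinity>\<close>; so the product stays
  bounded away from 0 provided no factor vanishes. A factor vanishes only if \<open>4 Re \<theta>\<^sup>j\<close> is an
  odd integer. As \<open>|\<theta>|\<^sup>2 < 2\<close>, the norm of \<open>\<theta>\<close> is \<open>\<plusminus>1\<close>, so \<open>\<theta>\<close> is a unit and
  \<open>2 Re \<theta>\<^sup>j\<close> is an algebraic integer for every integer \<open>j\<close>, which excludes this. Hence the
  Fourier transform does not vanish at infinity, and \<open>\<nu>\<^sub>\<lambda>\<close> is not absolutely continuous by the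
  Riemann-Lebesgue lemma. By Kolmogorov's zero-one law \<open>\<nu>\<^sub>\<lambda>\<close> is either absolutely continuous
  or singular (Jessen-Wintner).
\<close>

section \<open>Complex Pisot numbers\<close>

text \<open>Lets \<open>p\<close> act as a minimal polynomial without leaving Z[X]. For a vanishing
  \<open>g\<close> of least degree, pseudo-division of \<open>p\<close> by \<open>g\<close> leaves
  remainder 0, so the prime \<open>p\<close> divides \<open>g * q\<close>. It cannot divide
  \<open>q\<close>, since cancelling \<open>p\<close> would make the nonconstant \<open>g\<close>
  divide a nonzero constant.\<close>

lemma irreducible_int_poly_degree_le:
  fixes p f :: "int poly" and x :: complex
  assumes irr: "Factorial_Ring.irreducible p" and px: "poly (map_poly of_int p) x = 0"
    and f0: "f \<noteq> 0" and fx: "poly (map_poly of_int f) x = 0"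
  shows "degree p \<le> degree f"
proof -
  define Q where "Q f \<longleftrightarrow> f \<noteq> 0 \<and> poly (map_poly of_int f) x = 0" for f :: "int poly"
  have "Q f" using f0 fx by (simp add: Q_def)
  then obtain g where g: "Q g" and gmin: "\<And>h. Q h \<Longrightarrow> degree g \<le> degree h"
    using arg_min_nat_lemma[of Q f degree] by blast
  have g0: "g \<noteq> 0" and gx: "poly (map_poly of_int g) x = 0" using g by (auto simp: Q_def)
  have dg: "degree g \<noteq> 0"
  proof
    assume "degree g = 0"
    then obtain c where "g = [:c:]" by (metis degree_eq_zeroE)
    with g0 gx show False by (auto simp: map_poly_pCons)
  qed
  obtain a q where a: "a \<noteq> 0" and q: "Polynomial.smult a p = g * q + pseudo_mod p g"
    using pseudo_mod(1)[OF g0] by blast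
  have "poly (map_poly of_int (Polynomial.smult a p)) x = 0"
    using px by (simp add: of_int_hom.map_poly_hom_smult)
  then have "poly (map_poly of_int (pseudo_mod p g)) x = 0"
    using gx by (simp add: q of_int_poly_hom.hom_add of_int_poly_hom.hom_mult)
  then have r: "pseudo_mod p g = 0"
    using pseudo_mod(2)[OF g0, of p] gmin[of "pseudo_mod p g"] unfolding Q_def by linarith
  have "prime_elem p" using irr by (simp add: prime_elem_iff_irreducible)
  moreover have "p dvd g * q" using q r by (metis add.right_neutral dvd_smult dvd_refl)
  ultimately have "p dvd g \<or> p dvd q" by (rule prime_elem_dvd_multD)
  then have "degree p \<le> degree g"
  proof
    assume "p dvd g" then show ?thesis using g0 by (rule dvd_imp_degree_le)
  next
    assume "p dvd q"
    then obtain s where s: "q = p * s" by auto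
    have p0: "p \<noteq> 0" using irr by auto
    have "p * [:a:] = p * (g * s)" using q r s by (simp add: mult_ac)
    then have e: "[:a:] = g * s" using mult_left_cancel[OF p0] by blast
    then have "s \<noteq> 0" using a by auto
    then have "degree (g * s) = degree g + degree s" using g0 by (simp add: degree_mult_eq)
    then show ?thesis using e dg by (metis add_is_0 degree_pCons_0)
  qed
  also have "\<dots> \<le> degree f" using gmin \<open>Q f\<close> by blast
  finally show ?thesis .
qed

section \<open>Algebraic integers through integer matrices\<close>

text \<open>The determinant trick: \<open>x\<close> is an eigenvalue of an integer matrix, hence a
  root of its characteristic polynomial, which is monic over the integers. The index
  \<open>i0\<close> ensures that the eigenvector is nonzero.\<close>

lemma algebraic_int_of_integer_matrix:
  fixes x :: complex and v :: "'i \<Rightarrow> complex" and A :: "'i \<Rightarrow> 'i \<Rightarrow> int"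
  assumes I: "finite I" and i0: "i0 \<in> I" "v i0 \<noteq> 0"
    and eig: "\<And>i. i \<in> I \<Longrightarrow> x * v i = (\<Sum>j\<in>I. of_int (A i j) * v j)"
  shows "algebraic_int x"
proof -
  obtain h where h: "bij_betw h {0..<card I} I" using ex_bij_betw_nat_finite[OF I] by blast
  define n where "n = card I"
  define B where "B = mat n n (\<lambda>(i,j). A (h i) (h j))"
  define C where "C = map_mat complex_of_int B"
  define w where "w = Matrix.vec n (\<lambda>i. v (h i))"
  have B: "B \<in> carrier_mat n n" and C: "C \<in> carrier_mat n n" by (auto simp: B_def C_def)
  have hI: "h i \<in> I" if "i < n" for i using h that by (auto simp: bij_betw_def n_def)
  obtain k where k: "k < n" "h k = i0"
    using h i0 unfolding bij_betw_def n_def by (metis atLeastLessThan_iff imageE)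
  have "C *\<^sub>v w = x \<cdot>\<^sub>v w"
  proof (rule eq_vecI)
    fix i assume "i < dim_vec (x \<cdot>\<^sub>v w)"
    then have i: "i < n" by (simp add: w_def)
    have "vec_index (C *\<^sub>v w) i = (\<Sum>j\<in>{0..<n}. of_int (A (h i) (h j)) * v (h j))"
      using i by (auto simp: C_def B_def w_def scalar_prod_def intro!: sum.cong)
    also have "\<dots> = (\<Sum>j\<in>I. of_int (A (h i) j) * v j)"
      using h unfolding n_def by (rule sum.reindex_bij_betw)
    also have "\<dots> = x * v (h i)" using eig[OF hI[OF i]] by simp
    finally show "vec_index (C *\<^sub>v w) i = vec_index (x \<cdot>\<^sub>v w) i" using i by (simp add: w_def)
  qed (simp add: C_def B_def w_def)
  moreover have "w \<noteq> 0\<^sub>v n" using k i0 by (auto simp: w_def dest: arg_cong[of _ _ "\<lambda>u. vec_index u k"])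
  moreover have "w \<in> carrier_vec n" by (simp add: w_def)
  ultimately have "eigenvalue C x"
    using C unfolding eigenvalue_def eigenvector_def by auto
  then have "poly (char_poly C) x = 0" using eigenvalue_root_char_poly[OF C] by simp
  then have "poly (map_poly of_int (char_poly B)) x = 0"
    unfolding C_def using of_int_hom.char_poly_hom[OF B] by metis
  moreover have "lead_coeff (char_poly B) = 1" using degree_monic_char_poly[OF B] by simp
  ultimately show ?thesis unfolding algebraic_int_altdef_ipoly by blast
qed

lemma monic_root_degree_pos:
  fixes p :: "int poly" and x :: complex
  assumes "lead_coeff p = 1" "poly (map_poly of_int p) x = 0"
  shows "degree p > 0"
proof (rule ccontr)
  assume "\<not> degree p > 0"
  then have "degree p = 0" by simp
  then have "p = 1" by (rule monic_degree_0[OF assms(1), THEN iffD1])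
  with assms(2) show False by simp
qed

text \<open>Induction on \<open>n\<close>: multiplying by \<open>x\<close> shifts the coefficients,
  and only the overflowing top term has to be rewritten by the monic equation.\<close>

lemma monic_root_power_reduce:
  fixes p :: "int poly" and x :: complex
  assumes "lead_coeff p = 1" "poly (map_poly of_int p) x = 0"
  shows "\<exists>c :: nat \<Rightarrow> int. x ^ n = (\<Sum>i<degree p. of_int (c i) * x ^ i)"
proof (induction n)
  case 0
  have "degree p \<noteq> 0" using monic_root_degree_pos[OF assms] by simp
  then have "x ^ 0 = (\<Sum>i<degree p. of_int (if i = 0 then 1 else 0) * x ^ i)"
    by (simp add: if_distrib[of of_int] if_distrib[of "\<lambda>u. u * _"] cong: if_cong)
  then show ?case by (intro exI[of _ "\<lambda>i. if i = 0 then 1 else 0"])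
next
  case (Suc n)
  then obtain c :: "nat \<Rightarrow> int" where c: "x ^ n = (\<Sum>i<degree p. of_int (c i) * x ^ i)" by blast
  define d where "d = degree p"
  have "0 = (\<Sum>i\<le>d. of_int (coeff p i) * x ^ i)"
    using assms(2) by (simp add: poly_altdef d_def)
  also have "\<dots> = (\<Sum>i<d. of_int (coeff p i) * x ^ i) + x ^ d"
    using assms(1) by (simp add: lessThan_Suc_atMost[symmetric] d_def)
  finally have xd: "x ^ d = - (\<Sum>i<d. of_int (coeff p i) * x ^ i)" by (simp add: eq_neg_iff_add_eq_0 add.commute)
  have "d \<noteq> 0" using monic_root_degree_pos[OF assms] by (simp add: d_def)
  then obtain e where e: "d = Suc e" by (cases d) auto
  \<comment> \<open>\<open>c e\<close> is the coefficient carried to \<open>x ^ d\<close>; rewriting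
    \<open>x ^ d\<close> subtracts \<open>c e\<close> times the lower coefficients of
    \<open>p\<close>. At \<open>i = 0\<close> nothing is shifted in.\<close>
  define c' where "c' i = (if i = 0 then 0 else c (i - 1)) - c e * coeff p i" for i
  have "x ^ Suc n = (\<Sum>i<d. of_int (c i) * x ^ Suc i)"
    by (simp add: c d_def sum_distrib_left mult_ac)
  also have "\<dots> = (\<Sum>i<e. of_int (c i) * x ^ Suc i) + of_int (c e) * x ^ d"
    by (simp add: e)
  also have "(\<Sum>i<e. of_int (c i) * x ^ Suc i) = (\<Sum>i<d. of_int (if i = 0 then 0 else c (i - 1)) * x ^ i)"
    unfolding e by (subst sum.lessThan_Suc_shift) simp
  also have "\<dots> + of_int (c e) * x ^ d = (\<Sum>i<d. of_int (c' i) * x ^ i)"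
    unfolding xd c'_def by (simp add: sum_distrib_left sum_subtractf[symmetric] algebra_simps)
  finally show ?case unfolding d_def by (intro exI[of _ c'])
qed

text \<open>The products of a power of \<open>x\<close> below the degree of \<open>p\<close> with a
  power of \<open>y\<close> below the degree of \<open>q\<close> span a Z-module stable under
  multiplication by \<open>x ^ n + y ^ m\<close>; they form the eigenvector for the matrix
  criterion.\<close>

lemma algebraic_int_sum_powers:
  fixes x y :: complex
  assumes x: "algebraic_int x" and y: "algebraic_int y"
  shows "algebraic_int (x ^ n + y ^ m)"
proof -
  obtain p :: "int poly" where p: "poly (map_poly of_int p) x = 0" "lead_coeff p = 1"
    using x unfolding algebraic_int_altdef_ipoly by blast
  obtain q :: "int poly" where q: "poly (map_poly of_int q) y = 0" "lead_coeff q = 1"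
    using y unfolding algebraic_int_altdef_ipoly by blast
  define d where "d = degree p"
  define e where "e = degree q"
  have "\<forall>i. \<exists>c :: nat \<Rightarrow> int. x ^ (n + i) = (\<Sum>l<d. of_int (c l) * x ^ l)"
    unfolding d_def by (intro allI monic_root_power_reduce p)
  from choice[OF this] obtain a :: "nat \<Rightarrow> nat \<Rightarrow> int"
    where a: "\<And>i. x ^ (n + i) = (\<Sum>l<d. of_int (a i l) * x ^ l)" by auto
  have "\<forall>i. \<exists>c :: nat \<Rightarrow> int. y ^ (m + i) = (\<Sum>l<e. of_int (c l) * y ^ l)"
    unfolding e_def by (intro allI monic_root_power_reduce q)
  from choice[OF this] obtain b :: "nat \<Rightarrow> nat \<Rightarrow> int"
    where b: "\<And>i. y ^ (m + i) = (\<Sum>l<e. of_int (b i l) * y ^ l)" by auto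
  have de: "d > 0" "e > 0"
    unfolding d_def e_def using monic_root_degree_pos p q by blast+
  define I where "I = {..<d} \<times> {..<e}"
  define v where "v = (\<lambda>(i,j). x ^ i * y ^ j)"
  \<comment> \<open>In row \<open>(i,j)\<close>, multiplying by \<open>x ^ n\<close> affects only
    the first exponent and multiplying by \<open>y ^ m\<close> only the second; the two
    contributions add up.\<close>
  define A where "A = (\<lambda>(i,j) (k,l). (if l = j then a i k else 0) + (if k = i then b j l else 0))"
  show ?thesis
  proof (rule algebraic_int_of_integer_matrix[of I "(0,0)" v _ A])
    fix ij assume "ij \<in> I"
    then obtain i j where ij: "ij = (i,j)" "i < d" "j < e" by (auto simp: I_def)
    have "(\<Sum>kl\<in>I. of_int (A ij kl) * v kl) = (\<Sum>k<d. \<Sum>l<e. of_int (A ij (k,l)) * v (k,l))"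
      by (simp add: I_def sum.cartesian_product)
    also have "\<dots> = (\<Sum>k<d. \<Sum>l<e. (if l = j then of_int (a i k) * x ^ k * y ^ l else 0))
        + (\<Sum>k<d. \<Sum>l<e. (if k = i then of_int (b j l) * x ^ k * y ^ l else 0))"
      unfolding sum.distrib[symmetric] by (intro sum.cong refl) (auto simp: A_def v_def ij algebra_simps)
    also have "(\<Sum>k<d. \<Sum>l<e. (if l = j then of_int (a i k) * x ^ k * y ^ l else 0))
        = (\<Sum>k<d. of_int (a i k) * x ^ k * y ^ j)" using ij by simp
    also have "\<dots> = x ^ (n + i) * y ^ j" by (simp add: a sum_distrib_right)
    also have "(\<Sum>k<d. \<Sum>l<e. (if k = i then of_int (b j l) * x ^ k * y ^ l else 0))
        = (\<Sum>l<e. of_int (b j l) * x ^ i * y ^ l)" using ij by (subst sum.swap) simp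
    also have "\<dots> = x ^ i * y ^ (m + j)" by (simp add: b sum_distrib_left mult_ac)
    finally show "(x ^ n + y ^ m) * v ij = (\<Sum>kl\<in>I. of_int (A ij kl) * v kl)"
      by (simp add: v_def ij algebra_simps power_add)
  qed (use de in \<open>auto simp: I_def v_def\<close>)
qed

text \<open>A zero would make \<open>x ^ n + cnj x ^ n\<close> half of an odd integer, but this sum
  is an algebraic integer, and a rational algebraic integer is an integer.\<close>

lemma cos_conjugate_power_nonzero:
  assumes "algebraic_int x"
  shows "cos (2 * pi * Re (x ^ n)) \<noteq> 0"
proof
  assume "cos (2 * pi * Re (x ^ n)) = 0"
  then obtain i where i: "odd i" "2 * pi * Re (x ^ n) = of_int i * (pi / 2)"
    unfolding cos_zero_iff_int by blast
  then have r: "2 * Re (x ^ n) = of_int i / 2" by (simp add: field_simps)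
  have "poly (map_poly of_int p) (cnj x) = cnj (poly (map_poly of_int p) x)" for p :: "int poly"
    by (rule poly_cnj_real[symmetric]) simp
  then have "algebraic_int (cnj x)"
    using assms unfolding algebraic_int_altdef_ipoly by (metis complex_cnj_zero)
  then have "algebraic_int (x ^ n + cnj x ^ n)" by (rule algebraic_int_sum_powers[OF assms])
  moreover have eq: "x ^ n + cnj x ^ n = of_int i / 2"
  proof -
    have "x ^ n + cnj x ^ n = complex_of_real (2 * Re (x ^ n))"
      using complex_add_cnj[of "x ^ n"] by simp
    also have "\<dots> = of_int i / 2" unfolding r by simp
    finally show ?thesis .
  qed
  ultimately have "(of_int i / 2 :: complex) \<in> \<int>"
    by (intro rational_algebraic_int_is_int) (auto simp: eq)
  then obtain k where "(of_int i / 2 :: complex) = of_int k" by (auto elim: Ints_cases)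
  then have "of_int i = (of_int (2 * k) :: complex)" by (simp add: field_simps)
  then have "i = 2 * k" using of_int_eq_iff by blast
  then show False using i by simp
qed

text \<open>Newton's identities as \<open>S P = n P - X P'\<close>, where \<open>P\<close> is the reversed polynomial and
  \<open>S\<close> the generating function of the power sums; since \<open>P\<close> has constant term 1, this determines
  \<open>S\<close> over the integers.\<close>

lemma power_sum_roots_Ints:
  fixes zs :: "complex list" and p :: "int poly"
  assumes p: "map_poly of_int p = (\<Prod>z\<leftarrow>zs. [:-z, 1:])"
  shows "(\<Sum>z\<leftarrow>zs. z ^ k) \<in> \<int>"
proof -
  define P where "P zs = (\<Prod>z\<leftarrow>zs. [:1, -z:])" for zs :: "complex list"
  define S where "S zs = Abs_fps (\<lambda>k. \<Sum>z\<leftarrow>zs. z ^ k)" for zs :: "complex list"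
  \<comment> \<open>The geometric series in \<open>z\<close> is inverse to the linear factor; this
    yields the single extra summand \<open>P zs\<close> in the induction step below.\<close>
  have fps_lin: "Abs_fps (\<lambda>k. z ^ k) * fps_of_poly [:1, -z:] = 1" for z :: complex
  proof (rule fps_ext)
    fix n show "fps_nth (Abs_fps (\<lambda>k. z ^ k) * fps_of_poly [:1, -z:]) n = fps_nth 1 n"
      by (cases n) (simp_all add: fps_of_poly_pCons algebra_simps flip: fps_const_neg)
  qed
  have id: "S zs * fps_of_poly (P zs) = fps_of_poly (of_nat (length zs) * P zs - [:0,1:] * pderiv (P zs))" for zs
  proof (induction zs)
    case Nil
    then show ?case by (simp add: S_def P_def fps_eq_iff)
  next
    case (Cons z zs)
    have S: "S (z # zs) = Abs_fps (\<lambda>k. z ^ k) + S zs" by (simp add: S_def fps_eq_iff)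
    have P: "P (z # zs) = [:1, -z:] * P zs" by (simp add: P_def)
    have "S (z # zs) * fps_of_poly (P (z # zs)) =
      (Abs_fps (\<lambda>k. z ^ k) * fps_of_poly [:1, -z:]) * fps_of_poly (P zs)
      + fps_of_poly [:1, -z:] * (S zs * fps_of_poly (P zs))"
      unfolding S P fps_of_poly_mult by (simp add: algebra_simps)
    also have "\<dots> = fps_of_poly (P zs + [:1, -z:] * (of_nat (length zs) * P zs - [:0,1:] * pderiv (P zs)))"
      unfolding fps_lin Cons.IH by (simp add: fps_of_poly_mult fps_of_poly_add fps_of_poly_diff)
    also have "P zs + [:1, -z:] * (of_nat (length zs) * P zs - [:0,1:] * pderiv (P zs))
      = of_nat (length (z # zs)) * P (z # zs) - [:0,1:] * pderiv (P (z # zs))"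
    proof -
      have e1: "pderiv (P (z # zs)) = [:1,-z:] * pderiv (P zs) + P zs * [:-z:]"
        unfolding P pderiv_mult by (simp add: pderiv_pCons)
      \<comment> \<open>Splitting the linear factor lets ring simplification cancel the extra
        \<open>P zs\<close> against the term that the derivative of this factor contributes.\<close>
      have e2: "[:1,-z:] = 1 + [:0,1:] * [:-z:]" by (simp add: one_pCons)
      show ?thesis unfolding e1 unfolding P unfolding e2 by (simp only: length_Cons of_nat_Suc) (simp add: algebra_simps)
    qed
    finally show ?case .
  qed
  \<comment> \<open>Reversal is multiplicative, so the product of the reversed linear factors
    inherits integer coefficients from \<open>p\<close>.\<close>
  have refl: "P zs = reflect_poly (map_poly of_int p)"
  proof -
    have lin: "reflect_poly [:-z, 1:] = [:1, -z:]" for z :: complex by (simp add: reflect_poly_def)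
    show ?thesis
      unfolding p P_def by (induction zs) (simp_all only: list.map prod_list.Nil prod_list.Cons
        reflect_poly_mult lin reflect_poly_1)
  qed
  have Pint: "coeff (P zs) i \<in> \<int>" for i
    unfolding refl by (simp add: coeff_reflect_poly)
  have P0: "coeff (P zs) 0 = 1" unfolding P_def by (induction zs) (auto simp: coeff_mult)
  have rhs: "fps_nth (fps_of_poly (of_nat (length zs) * P zs - [:0,1:] * pderiv (P zs))) n \<in> \<int>" for n
    using Pint by (cases n) (auto simp: coeff_pderiv coeff_pCons of_nat_poly intro!: Ints_mult Ints_diff Ints_add)
  have "fps_nth (S zs) n \<in> \<int>" for n
  proof (induction n rule: less_induct)
    case (less n)
    \<comment> \<open>The constant term of \<open>P zs\<close> is 1, so the newest power sum can be
      isolated from this convolution without division.\<close>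
    have "fps_nth (S zs * fps_of_poly (P zs)) n = (\<Sum>i\<le>n. fps_nth (S zs) i * coeff (P zs) (n - i))"
      by (simp add: fps_mult_nth atLeast0AtMost)
    also have "\<dots> = (\<Sum>i<n. fps_nth (S zs) i * coeff (P zs) (n - i)) + fps_nth (S zs) n"
      by (simp add: lessThan_Suc_atMost[symmetric] P0)
    finally have "fps_nth (S zs) n = fps_nth (S zs * fps_of_poly (P zs)) n - (\<Sum>i<n. fps_nth (S zs) i * coeff (P zs) (n - i))" by simp
    also have "\<dots> \<in> \<int>"
      using rhs[of n] less Pint unfolding id by (intro Ints_diff Ints_sum Ints_mult) auto
    finally show ?case .
  qed
  then show ?thesis by (simp add: S_def)
qed

section \<open>The minimal polynomial of a complex Pisot number\<close>

text \<open>\<open>complex_pisot\<close> constrains the set of roots, not their multiplicities.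
  Irreducibility makes \<theta> and its conjugate simple roots, so every entry of \<open>zs\<close>
  is a small conjugate; it also excludes the root 0.\<close>

lemma complex_pisot_factorization:
  assumes "complex_pisot \<theta>"
  obtains p :: "int poly" and zs :: "complex list"
  where "lead_coeff p = 1" "coeff p 0 \<noteq> 0"
    "map_poly of_int p = (\<Prod>z\<leftarrow>\<theta> # cnj \<theta> # zs. [:-z, 1:])"
    "\<And>z. z \<in> set zs \<Longrightarrow> norm z < 1"
proof -
  from assms obtain p :: "int poly" where
    nr: "\<theta> \<notin> \<real>" and n1: "norm \<theta> > 1" and lp: "lead_coeff p = 1" and irr: "Factorial_Ring.irreducible p" and
    root: "poly (map_poly of_int p) \<theta> = 0" and
    conj: "\<And>z. poly (map_poly of_int p) z = 0 \<Longrightarrow> z \<noteq> \<theta> \<Longrightarrow> z \<noteq> cnj \<theta> \<Longrightarrow> norm z < 1"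
    unfolding complex_pisot_def by blast
  define P where "P = (map_poly of_int p :: complex poly)"
  have deg: "degree p > 0" using monic_root_degree_pos[OF lp root] .
  have neq: "\<theta> \<noteq> cnj \<theta>" using nr by (metis complex_is_Real_iff cnj.simps(2) equal_neg_zero)
  have cnjP: "poly (map_poly of_int f) (cnj z) = cnj (poly (map_poly of_int f) z)" for z and f :: "int poly"
    by (rule poly_cnj_real[symmetric]) simp
  obtain Q where Q: "P = [:-\<theta>, 1:] * Q" using root unfolding P_def poly_eq_0_iff_dvd by (auto elim: dvdE)
  have "poly P (cnj \<theta>) = 0" using cnjP[of p \<theta>] root by (simp add: P_def)
  then have "poly Q (cnj \<theta>) = 0" using neq by (simp add: Q)
  then obtain R where R: "Q = [:-cnj \<theta>, 1:] * R" unfolding poly_eq_0_iff_dvd by (auto elim: dvdE)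
  have PR: "P = [:-\<theta>, 1:] * ([:-cnj \<theta>, 1:] * R)" using Q R by simp
  have "lead_coeff P = 1" unfolding P_def using lp by simp
  then have lR: "lead_coeff R = 1" unfolding PR lead_coeff_mult by simp
  obtain zs where zs: "R = (\<Prod>z\<leftarrow>zs. [:-z, 1:])"
    using fundamental_theorem_algebra_factorized[of R] lR by auto
  \<comment> \<open>The nonzero derivative has smaller degree, so by minimality it cannot share the
    root \<theta> with \<open>p\<close>.\<close>
  have simple: "poly (map_poly of_int (pderiv p)) \<theta> \<noteq> 0"
  proof
    assume "poly (map_poly of_int (pderiv p)) \<theta> = 0"
    moreover have "pderiv p \<noteq> 0" using deg by (simp add: pderiv_eq_0_iff)
    ultimately have "degree p \<le> degree (pderiv p)"
      using irreducible_int_poly_degree_le[OF irr root] by blast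
    then show False using deg by (simp add: degree_pderiv)
  qed
  have dP: "map_poly of_int (pderiv p) = pderiv P"
    unfolding P_def by (rule of_int_hom.map_poly_pderiv)
  have R\<theta>: "poly R \<theta> \<noteq> 0"
  proof
    assume "poly R \<theta> = 0"
    then have "poly (pderiv P) \<theta> = 0" unfolding PR pderiv_mult by (simp add: pderiv_pCons)
    with simple show False by (simp add: dP)
  qed
  have Rc: "poly R (cnj \<theta>) \<noteq> 0"
  proof
    assume "poly R (cnj \<theta>) = 0"
    then have "poly (pderiv P) (cnj \<theta>) = 0" unfolding PR pderiv_mult by (simp add: pderiv_pCons)
    then have "cnj (poly (map_poly of_int (pderiv p)) \<theta>) = 0"
      using cnjP[of "pderiv p" \<theta>] by (simp add: dP)
    with simple show False by simp
  qed
  have c0: "coeff p 0 \<noteq> 0"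
  proof
    assume "coeff p 0 = 0"
    then obtain f where f: "p = pCons 0 f" by (cases p) auto
    have "f \<noteq> 0" using f deg by auto
    moreover have "poly (map_poly of_int f) \<theta> = 0"
      using root n1 unfolding f of_int_hom.map_poly_pCons_hom by auto
    ultimately have "degree p \<le> degree f"
      using irreducible_int_poly_degree_le[OF irr root] by blast
    then show False using f \<open>f \<noteq> 0\<close> by simp
  qed
  have small: "norm z < 1" if "z \<in> set zs" for z
  proof -
    have "poly R z = 0" using that unfolding zs by (induction zs) auto
    then have "z \<noteq> \<theta>" "z \<noteq> cnj \<theta>" "poly P z = 0" using R\<theta> Rc by (auto simp: PR)
    then show ?thesis using conj by (simp add: P_def)
  qed
  show thesis
    by (rule that[of p zs]) (use lp c0 small PR zs in \<open>simp_all add: P_def\<close>)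
qed

text \<open>The modulus of the constant term is the product of the moduli of all roots, at most the
  square of \<open>norm \<theta>\<close> and so below 2. A nonzero integer this small is 1 or -1,
  which makes \<theta> a unit.\<close>

lemma complex_pisot_algebraic_int_inverse:
  assumes "complex_pisot \<theta>" "norm \<theta> < sqrt 2"
  shows "algebraic_int (1 / \<theta>)"
proof -
  obtain p :: "int poly" and zs where p: "lead_coeff p = 1" "coeff p 0 \<noteq> 0"
    "map_poly of_int p = (\<Prod>z\<leftarrow>\<theta> # cnj \<theta> # zs. [:-z, 1:])"
    and zs: "\<And>z. z \<in> set zs \<Longrightarrow> norm z < 1"
    using complex_pisot_factorization[OF assms(1)] by metis
  have le: "norm (\<Prod>z\<leftarrow>zs. - z) \<le> 1" using zs
    by (induction zs) (auto simp: norm_mult less_imp_le intro!: mult_le_one)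
  have "of_int (coeff p 0) = poly (map_poly of_int p) (0::complex)"
    by (simp add: poly_0_coeff_0)
  also have "\<dots> = \<theta> * cnj \<theta> * (\<Prod>z\<leftarrow>zs. - z)"
    unfolding p(3) by (simp add: poly_prod_list o_def)
  finally have "norm (of_int (coeff p 0) :: complex) = norm \<theta> * norm \<theta> * norm (\<Prod>z\<leftarrow>zs. - z)"
    by (simp add: norm_mult)
  also have "\<dots> \<le> norm \<theta> * norm \<theta> * 1" using le by (intro mult_left_mono) auto
  also have "\<dots> < 2"
  proof -
    have "norm \<theta> * norm \<theta> < sqrt 2 * sqrt 2"
      using assms(2) by (intro mult_strict_mono') auto
    then show ?thesis by simp
  qed
  finally have "\<bar>coeff p 0\<bar> < 2" by (simp flip: of_int_abs)
  then have u: "coeff p 0 = 1 \<or> coeff p 0 = -1" using p(2) by auto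
  have root: "poly (map_poly of_int p) \<theta> = 0" unfolding p(3) by simp
  \<comment> \<open>Scaling by the sign brings the constant term to 1, as
    \<open>algebraic_int_inverse\<close> requires.\<close>
  define q where "q = Polynomial.smult (coeff p 0) p"
  have "algebraic_int (inverse \<theta>)"
  proof (rule algebraic_int_inverse)
    show "poly (map_poly of_int q) \<theta> = 0" by (simp add: q_def of_int_hom.map_poly_hom_smult root)
    show "coeff (map_poly of_int q :: complex poly) 0 = 1" using u by (auto simp: q_def)
  qed auto
  then show ?thesis by (simp add: divide_inverse)
qed

text \<open>The power sum over all roots is an integer, and the roots in \<open>zs\<close>
  contribute at most \<open>length zs\<close> times the \<open>k\<close>-th power of a bound on
  their moduli.\<close>

lemma complex_pisot_trace_near_int:
  assumes "complex_pisot \<theta>"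
  obtains C r :: real and m :: "nat \<Rightarrow> int"
  where "0 \<le> r" "r < 1" "\<And>k. \<bar>2 * Re (\<theta> ^ k) - of_int (m k)\<bar> \<le> C * r ^ k"
proof -
  obtain p :: "int poly" and zs where p: "map_poly of_int p = (\<Prod>z\<leftarrow>\<theta> # cnj \<theta> # zs. [:-z, 1:])"
    and zs: "\<And>z. z \<in> set zs \<Longrightarrow> norm z < 1"
    using complex_pisot_factorization[OF assms] by metis
  \<comment> \<open>Inserting 0 keeps \<open>Max\<close> meaningful when \<open>zs\<close> is empty,
    that is, for quadratic \<theta>.\<close>
  define r where "r = Max (insert 0 (norm ` set zs))"
  have r: "0 \<le> r" "r < 1" "\<And>z. z \<in> set zs \<Longrightarrow> norm z \<le> r"
    using zs by (auto simp: r_def)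
  have bound: "norm (\<Sum>z\<leftarrow>zs. z ^ k) \<le> real (length zs) * r ^ k" for k
    using r(3)
  proof (induction zs)
    case (Cons z zs)
    have "norm (z ^ k) \<le> r ^ k" unfolding norm_power using Cons.prems by (intro power_mono) auto
    with Cons show ?case by (auto intro!: norm_triangle_le simp: algebra_simps)
  qed simp
  have "\<exists>m::int. \<bar>2 * Re (\<theta> ^ k) - of_int m\<bar> \<le> real (length zs) * r ^ k" for k
  proof -
    obtain m where m: "(\<Sum>z\<leftarrow>\<theta> # cnj \<theta> # zs. z ^ k) = of_int m"
      using power_sum_roots_Ints[OF p, of k] by (auto elim: Ints_cases)
    then have "\<theta> ^ k + cnj (\<theta> ^ k) + (\<Sum>z\<leftarrow>zs. z ^ k) = of_int m" by (simp add: add.assoc)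
    from arg_cong[OF this, of Re] have "2 * Re (\<theta> ^ k) + Re (\<Sum>z\<leftarrow>zs. z ^ k) = of_int m"
      by (simp only: plus_complex.simps cnj.simps complex_Re_of_int mult_2)
    then have "\<bar>2 * Re (\<theta> ^ k) - of_int m\<bar> \<le> norm (\<Sum>z\<leftarrow>zs. z ^ k)"
      using abs_Re_le_cmod[of "\<Sum>z\<leftarrow>zs. z ^ k"] by linarith
    then show ?thesis using bound[of k] by (intro exI[of _ m]) simp
  qed
  then have "\<forall>k. \<exists>m::int. \<bar>2 * Re (\<theta> ^ k) - of_int m\<bar> \<le> real (length zs) * r ^ k" by blast
  from choice[OF this] obtain m :: "nat \<Rightarrow> int" where
    "\<And>k. \<bar>2 * Re (\<theta> ^ k) - of_int (m k)\<bar> \<le> real (length zs) * r ^ k" by auto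
  then show thesis using that r by blast
qed

section \<open>Lower bounds for products of cosines\<close>

text \<open>Beyond some index the Weierstrass product inequality keeps the product above 1/2, and
  the finitely many earlier factors have a positive product. All finite index sets are covered at
  once because those met later vary with \<open>N\<close> and \<open>n\<close>.\<close>

lemma finite_prod_lower_bound:
  fixes a :: "nat \<Rightarrow> real"
  assumes pos: "\<And>k. 0 < a k" and le: "\<And>k. a k \<le> 1" and sm: "summable (\<lambda>k. 1 - a k)"
  obtains c where "c > 0" "\<And>F. finite F \<Longrightarrow> c \<le> prod a F"
proof -
  obtain N where N: "\<And>m n. m \<ge> N \<Longrightarrow> norm (\<Sum>k=m..<n. 1 - a k) < 1/2"
    using sm[unfolded summable_Cauchy, rule_format, of "1/2"] by auto
  define c where "c = prod a {..<N} / 2"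
  have "c \<le> prod a F" if F: "finite F" for F
  proof -
    obtain M where M: "F \<subseteq> {..<M}" using finite_nat_iff_bounded F by auto
    \<comment> \<open>Dropping factors from a product of numbers in (0,1] can only increase
      it.\<close>
    have "prod a {..<N} = prod a (F \<inter> {..<N}) * prod a ({..<N} - F)"
      by (subst prod.union_disjoint[symmetric]) (auto intro!: prod.cong)
    also have "\<dots> \<le> prod a (F \<inter> {..<N}) * 1"
      using pos le by (intro mult_left_mono prod_le_1 prod_nonneg) (auto intro: less_imp_le)
    finally have 1: "prod a {..<N} \<le> prod a (F \<inter> {..<N})" by simp
    have "(\<Sum>k\<in>F - {..<N}. 1 - a k) \<le> (\<Sum>k=N..<M. 1 - a k)"
      using M le by (intro sum_mono2) auto
    also have "\<dots> < 1/2" using N[of N M] by simp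
    finally have "1/2 \<le> 1 - (\<Sum>k\<in>F - {..<N}. 1 - a k)" by simp
    also have "\<dots> \<le> (\<Prod>k\<in>F - {..<N}. 1 - (1 - a k))"
      using pos le by (intro Weierstrass_prod_ineq) (auto intro: less_imp_le)
    finally have 2: "1/2 \<le> prod a (F - {..<N})" by simp
    have "c \<le> prod a (F \<inter> {..<N}) * prod a (F - {..<N})"
      unfolding c_def using mult_mono[OF 1 2] pos by (simp add: prod_nonneg less_imp_le)
    also have "\<dots> = prod a F"
      using F by (subst prod.union_disjoint[symmetric]) (auto intro!: prod.cong)
    finally show ?thesis .
  qed
  then show thesis using that[of c] pos by (simp add: c_def prod_pos)
qed

text \<open>The square of the cosine is at most its absolute value, so the left side is at most the
  squared sine, which has period \<open>pi\<close> and is bounded by the square of its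
  argument.\<close>

lemma one_minus_abs_cos_le:
  fixes y :: real and m :: int
  shows "1 - \<bar>cos y\<bar> \<le> (y - pi * of_int m)\<^sup>2"
proof -
  have "(sin (y - pi * of_int m))\<^sup>2 = (sin y)\<^sup>2 * (cos (pi * of_int m))\<^sup>2"
    by (simp add: sin_diff power_mult_distrib)
  then have "(sin y)\<^sup>2 = (sin (y - pi * of_int m))\<^sup>2"
    by (simp add: cos_squared_eq)
  also have "\<dots> \<le> (y - pi * of_int m)\<^sup>2"
    using abs_sin_x_le_abs_x by (simp add: abs_le_square_iff)
  finally have s: "(sin y)\<^sup>2 \<le> (y - pi * of_int m)\<^sup>2" .
  have "(cos y)\<^sup>2 \<le> \<bar>cos y\<bar>"
    using abs_cos_le_one[of y] mult_left_le[of "\<bar>cos y\<bar>" "\<bar>cos y\<bar>"] by (simp add: power2_eq_square)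
  then show ?thesis using s by (simp add: cos_squared_eq)
qed

lemma summable_one_minus_abs_cos:
  fixes y :: "nat \<Rightarrow> real" and m :: "nat \<Rightarrow> int"
  assumes "0 \<le> r" "r < 1" and b: "\<And>k. \<bar>y k - pi * of_int (m k)\<bar> \<le> C * r ^ k"
  shows "summable (\<lambda>k. 1 - \<bar>cos (y k)\<bar>)"
proof (rule summable_comparison_test')
  have "norm (r\<^sup>2) < 1" using assms by (simp add: power2_less_1_iff abs_square_less_1)
  then show "summable (\<lambda>k. C\<^sup>2 * (r\<^sup>2) ^ k)" by (intro summable_mult summable_geometric)
  fix k
  have "1 - \<bar>cos (y k)\<bar> \<le> (y k - pi * of_int (m k))\<^sup>2" by (rule one_minus_abs_cos_le)
  also have "\<dots> \<le> (C * r ^ k)\<^sup>2" using b[of k] by (intro power2_le_iff_abs_le[THEN iffD2]) auto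
  also have "\<dots> = C\<^sup>2 * (r\<^sup>2) ^ k" by (simp add: power_mult_distrib power_mult[symmetric] mult.commute)
  finally show "norm (1 - \<bar>cos (y k)\<bar>) \<le> C\<^sup>2 * (r\<^sup>2) ^ k" by simp
qed

text \<open>The \<open>k\<close>-th factor involves \<theta> to the exponent \<open>N - k\<close>,
  read as an integer. Nonnegative exponents are controlled by the near-integer traces, negative ones
  by the decay of powers of \<open>1 / \<theta>\<close>. Neither family contains a zero, so both
  have positive bounds free of \<open>N\<close> and \<open>n\<close>.\<close>

lemma complex_pisot_cos_prod_lower_bound:
  assumes "complex_pisot \<theta>" "norm \<theta> < sqrt 2"
  obtains c where "c > 0"
    "\<And>N n. c \<le> (\<Prod>k<n. \<bar>cos (Re (of_real (2 * pi) * \<theta> ^ N * (1 / \<theta>) ^ k))\<bar>)"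
proof -
  have n1: "norm \<theta> > 1" using assms(1) by (simp add: complex_pisot_def)
  then have \<theta>0: "\<theta> \<noteq> 0" by auto
  have int: "algebraic_int \<theta>"
    using assms(1) unfolding complex_pisot_def algebraic_int_altdef_ipoly by blast
  have inv: "algebraic_int (1 / \<theta>)" by (rule complex_pisot_algebraic_int_inverse[OF assms])
  define a where "a z k = \<bar>cos (2 * pi * Re (z ^ k))\<bar>" for z :: complex and k :: nat
  have apos: "a z k > 0" if "algebraic_int z" for z k
    using cos_conjugate_power_nonzero[OF that] by (simp add: a_def)
  obtain C r and m :: "nat \<Rightarrow> int" where r: "0 \<le> r" "r < 1"
    and m: "\<And>k. \<bar>2 * Re (\<theta> ^ k) - of_int (m k)\<bar> \<le> C * r ^ k"
    using complex_pisot_trace_near_int[OF assms(1)] by metis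
  have ale: "a z k \<le> 1" for z k by (simp add: a_def)
  have sm1: "summable (\<lambda>k. 1 - a \<theta> k)" unfolding a_def
  proof (rule summable_one_minus_abs_cos[OF r])
    fix k
    have "2 * pi * Re (\<theta> ^ k) - pi * of_int (m k) = pi * (2 * Re (\<theta> ^ k) - of_int (m k))"
      by (simp add: algebra_simps)
    then have "\<bar>2 * pi * Re (\<theta> ^ k) - pi * of_int (m k)\<bar> = pi * \<bar>2 * Re (\<theta> ^ k) - of_int (m k)\<bar>"
      by (simp add: abs_mult)
    also have "\<dots> \<le> pi * (C * r ^ k)" using m by (intro mult_left_mono) auto
    finally show "\<bar>2 * pi * Re (\<theta> ^ k) - pi * of_int (m k)\<bar> \<le> (pi * C) * r ^ k" by (simp add: mult.assoc)
  qed
  obtain c1 where c1: "c1 > 0" "\<And>F. finite F \<Longrightarrow> c1 \<le> prod (a \<theta>) F"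
    using finite_prod_lower_bound[OF apos[OF int] ale sm1] by metis
  have sm2: "summable (\<lambda>k. 1 - a (1 / \<theta>) k)" unfolding a_def
  \<comment> \<open>Powers of \<open>1 / \<theta>\<close> tend to 0, so the multiple of
    \<open>pi\<close> to compare with is always 0.\<close>
  proof (rule summable_one_minus_abs_cos[of "norm (1 / \<theta>)" _ "\<lambda>_. 0" "2 * pi"])
    fix k
    have "\<bar>Re ((1 / \<theta>) ^ k)\<bar> \<le> norm (1 / \<theta>) ^ k"
      using abs_Re_le_cmod[of "(1 / \<theta>) ^ k"] by (simp only: norm_power)
    then show "\<bar>2 * pi * Re ((1 / \<theta>) ^ k) - pi * of_int 0\<bar> \<le> 2 * pi * norm (1 / \<theta>) ^ k"
      by (simp only: of_int_0 mult_zero_right diff_zero abs_mult) simp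
  qed (use n1 in \<open>auto simp: norm_divide divide_less_eq_1\<close>)
  obtain c2 where c2: "c2 > 0" "\<And>F. finite F \<Longrightarrow> c2 \<le> prod (a (1 / \<theta>)) F"
    using finite_prod_lower_bound[OF apos[OF inv] ale sm2] by metis
  show thesis
  proof (rule that[of "c1 * c2"])
    show "c1 * c2 > 0" using c1 c2 by simp
    fix N n
    define f where "f k = \<bar>cos (Re (of_real (2 * pi) * \<theta> ^ N * (1 / \<theta>) ^ k))\<bar>" for k
    \<comment> \<open>The index \<open>k = N\<close>, with exponent 0, goes to \<open>F\<close>;
      each of the truncated differences \<open>N - k\<close> on \<open>F\<close> and
      \<open>k - N\<close> on \<open>G\<close> is then exact.\<close>
    define F where "F = {k. k < n \<and> k \<le> N}"
    define G where "G = {k. k < n \<and> N < k}"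
    have fin: "finite F" "finite G" unfolding F_def G_def by simp_all
    have "(\<Prod>k<n. f k) = prod f F * prod f G"
      unfolding F_def G_def by (subst prod.union_disjoint[symmetric]) (auto intro!: prod.cong)
    also have "prod f F = (\<Prod>k\<in>F. a \<theta> (N - k))"
    proof (rule prod.cong[OF refl])
      fix k assume "k \<in> F"
      then have "\<theta> ^ N * (1 / \<theta>) ^ k = \<theta> ^ (N - k)"
        using \<theta>0 by (simp add: F_def power_diff power_divide)
      then show "f k = a \<theta> (N - k)" by (simp add: f_def a_def mult.assoc)
    qed
    \<comment> \<open>The reindexing is injective on \<open>F\<close>, giving a product over a
      finite set of exponents, to which \<open>c1\<close> applies whatever \<open>N\<close>
      is.\<close>
    also have "\<dots> = prod (a \<theta>) ((\<lambda>k. N - k) ` F)"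
      by (subst prod.reindex) (auto simp: F_def inj_on_def)
    also have "prod f G = (\<Prod>k\<in>G. a (1 / \<theta>) (k - N))"
    proof (rule prod.cong[OF refl])
      fix k assume "k \<in> G"
      then have "\<theta> ^ N * (1 / \<theta>) ^ k = (1 / \<theta>) ^ (k - N)"
        using \<theta>0 by (simp add: G_def power_diff power_divide)
      then show "f k = a (1 / \<theta>) (k - N)" by (simp add: f_def a_def mult.assoc)
    qed
    also have "\<dots> = prod (a (1 / \<theta>)) ((\<lambda>k. k - N) ` G)"
      by (subst prod.reindex) (auto simp: G_def inj_on_def)
    finally have eq: "(\<Prod>k<n. f k) = prod (a \<theta>) ((\<lambda>k. N - k) ` F) * prod (a (1 / \<theta>)) ((\<lambda>k. k - N) ` G)" .
    show "c1 * c2 \<le> (\<Prod>k<n. \<bar>cos (Re (of_real (2 * pi) * \<theta> ^ N * (1 / \<theta>) ^ k))\<bar>)"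
      unfolding f_def[symmetric] eq
      by (intro mult_mono c1(2) c2(2) finite_imageI fin less_imp_le[OF c2(1)] prod_nonneg) (simp add: a_def)
  qed
qed

section \<open>The Riemann-Lebesgue lemma\<close>

lemma measurable_exp_Re [measurable]: "(\<lambda>x. exp (\<i> * of_real (Re (w * x)))) \<in> borel_measurable borel"
  by (intro borel_measurable_continuous_onI continuous_intros)

lemma integrable_mult_exp_Re:
  assumes "integrable lborel f"
  shows "integrable lborel (\<lambda>x. f x * exp (\<i> * of_real (Re (w * x))))"
proof (rule Bochner_Integration.integrable_bound[OF assms])
  show "(\<lambda>x. f x * exp (\<i> * of_real (Re (w * x)))) \<in> borel_measurable lborel"
    using assms by measurable
qed (auto simp: norm_mult)

lemma integrable_complex_indicator:
  assumes "A \<in> sets M" "emeasure M A < \<infinity>"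
  shows "integrable M (\<lambda>x. indicator A x :: complex)"
proof -
  have "integrable M (\<lambda>x. complex_of_real (indicator A x))"
    using assms by (intro integrable_of_real integrable_real_indicator)
  then show ?thesis by (simp add: of_real_indicator)
qed

text \<open>Translating by \<open>\<pi> / w\<close> changes the sign of the exponential.\<close>

lemma Riemann_Lebesgue_open:
  fixes U :: "complex set" and w :: "nat \<Rightarrow> complex"
  assumes U: "open U" "emeasure lborel U < \<infinity>" and w: "filterlim (\<lambda>n. norm (w n)) at_top sequentially"
  shows "(\<lambda>n. \<integral>x. indicator U x * exp (\<i> * of_real (Re (w n * x))) \<partial>lborel) \<longlonglongrightarrow> 0"
proof -
  define e where "e n x = exp (\<i> * of_real (Re (w n * x)))" for n x
  define h where "h n = of_real pi / w n" for n
  define D where "D n x = (indicator U x - indicator U (h n + x) :: complex)" for n x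
  define A where "A n = (\<integral>x. indicator U x * e n x \<partial>lborel)" for n
  have em [measurable]: "e n \<in> borel_measurable borel" for n unfolding e_def by measurable
  have [measurable]: "U \<in> sets borel" using U by simp
  have iU: "integrable lborel (\<lambda>x. indicator U x :: complex)" using U by (simp add: integrable_complex_indicator)
  have iUh: "integrable lborel (\<lambda>x. indicator U (h n + x) :: complex)" for n
    using iU by (subst (asm) lborel_distr_plus[of "h n", symmetric]) (simp add: integrable_distr_eq)
  have h0: "h \<longlonglongrightarrow> 0"
  proof -
    have "(\<lambda>n. pi * inverse (norm (w n))) \<longlonglongrightarrow> pi * 0"
      by (intro tendsto_mult tendsto_const tendsto_inverse_0_at_top w)
    then have "(\<lambda>n. norm (h n)) \<longlonglongrightarrow> 0" by (simp add: h_def norm_divide divide_inverse norm_mult norm_inverse)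
    then show ?thesis by (rule tendsto_norm_zero_cancel)
  qed
  \<comment> \<open>If \<open>w n = 0\<close>, then \<open>h n = 0\<close> by the convention for
    division and the translation changes no sign; only finitely many \<open>n\<close> are
    affected.\<close>
  have wn0: "eventually (\<lambda>n. w n \<noteq> 0) sequentially"
    using filterlim_at_top_dense[THEN iffD1, OF w, rule_format, of 0] by eventually_elim auto
  have eh: "e n (h n + x) = - e n x" if "w n \<noteq> 0" for n x
  proof -
    have "w n * (h n + x) = of_real pi + w n * x" using that by (simp add: h_def field_simps)
    then show ?thesis by (simp add: e_def distrib_left exp_add)
  qed
  \<comment> \<open>The translated form of \<open>A n\<close> carries a minus sign, so adding both
    forms leaves the difference \<open>D n\<close> of two indicators.\<close>
  have A2: "2 * A n = (\<integral>x. D n x * e n x \<partial>lborel)" if "w n \<noteq> 0" for n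
  proof -
    have "A n = (\<integral>x. indicator U (h n + x) * e n (h n + x) \<partial>lborel)"
      unfolding A_def by (subst lborel_distr_plus[of "h n", symmetric]) (simp add: integral_distr)
    also have "\<dots> = - (\<integral>x. indicator U (h n + x) * e n x \<partial>lborel)" by (simp add: eh that)
    finally have "2 * A n = A n - (\<integral>x. indicator U (h n + x) * e n x \<partial>lborel)" by simp
    also have "\<dots> = (\<integral>x. indicator U x * e n x - indicator U (h n + x) * e n x \<partial>lborel)"
      unfolding A_def e_def
      by (intro Bochner_Integration.integral_diff[symmetric] integrable_mult_exp_Re iU iUh)
    finally show ?thesis by (simp add: D_def left_diff_distrib)
  qed
  define L :: "nat \<Rightarrow> real" where "L n = (\<integral>x. indicator U x * indicator U (h n + x) \<partial>lborel)" for n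
  define m where "m = measure lborel U"
  have iR: "integrable lborel (\<lambda>x. indicator U x :: real)" using U by (simp add: integrable_indicator_iff)
  have iRh: "integrable lborel (\<lambda>x. indicator U (h n + x) :: real)" for n
    using iR by (subst (asm) lborel_distr_plus[of "h n", symmetric]) (simp add: integrable_distr_eq)
  have iRR: "integrable lborel (\<lambda>x. indicator U x * indicator U (h n + x) :: real)" for n
    by (rule Bochner_Integration.integrable_bound[OF iR]) (auto simp: indicator_def)
  have mh: "(\<integral>x. indicator U (h n + x) \<partial>lborel) = m" for n
  proof -
    have "(\<integral>x. (indicator U x :: real) \<partial>distr lborel borel ((+) (h n))) = (\<integral>x. indicator U (h n + x) \<partial>lborel)"
      by (rule integral_distr) measurable
    then show ?thesis unfolding lborel_distr_plus by (simp add: m_def)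
  qed
  \<comment> \<open>Openness matters here: a point of \<open>U\<close> stays in \<open>U\<close>
    under small translations, so the overlap of \<open>U\<close> with its translates tends to the
    full measure.\<close>
  have "L \<longlonglongrightarrow> (\<integral>x. indicator U x \<partial>lborel)"
    unfolding L_def
  proof (rule integral_dominated_convergence[where w="indicator U"])
    show "AE x in lborel. (\<lambda>n. indicator U x * indicator U (h n + x)) \<longlonglongrightarrow> (indicator U x :: real)"
    proof (intro AE_I2)
      fix x :: complex
      show "(\<lambda>n. indicator U x * indicator U (h n + x)) \<longlonglongrightarrow> (indicator U x :: real)"
      proof (cases "x \<in> U")
        case True
        have "(\<lambda>n. h n + x) \<longlonglongrightarrow> 0 + x" by (intro tendsto_add h0 tendsto_const)
        then have "eventually (\<lambda>n. h n + x \<in> U) sequentially"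
          using topological_tendstoD[of _ x _ U] U True by simp
        then have "eventually (\<lambda>n. indicator U x * indicator U (h n + x) = (indicator U x :: real)) sequentially"
          by eventually_elim simp
        then show ?thesis by (rule tendsto_eventually)
      qed simp
    qed
    show "integrable lborel (indicator U :: complex \<Rightarrow> real)" using iR .
  qed (auto simp: indicator_def)
  then have L: "L \<longlonglongrightarrow> m" by (simp add: m_def)
  have bound: "norm (A n) \<le> m - L n" if "w n \<noteq> 0" for n
  proof -
    have "2 * norm (A n) = norm (\<integral>x. D n x * e n x \<partial>lborel)"
      unfolding A2[OF that, symmetric] by (simp add: norm_mult)
    \<comment> \<open>The modulus of \<open>D n\<close> is the indicator of a symmetric difference,
      written by inclusion-exclusion.\<close>
    also have "\<dots> \<le> (\<integral>x. indicator U x + indicator U (h n + x) - 2 * (indicator U x * indicator U (h n + x)) \<partial>lborel)"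
    proof (rule Bochner_Integration.integral_norm_bound_integral)
      show "integrable lborel (\<lambda>x. D n x * e n x)"
        unfolding D_def e_def by (intro integrable_mult_exp_Re Bochner_Integration.integrable_diff iU iUh)
      show "integrable lborel (\<lambda>x. indicator U x + indicator U (h n + x) - 2 * (indicator U x * indicator U (h n + x)) :: real)"
        by (intro Bochner_Integration.integrable_diff Bochner_Integration.integrable_add integrable_mult_right iR iRh iRR)
    qed (auto simp: D_def e_def norm_mult indicator_def)
    also have "\<dots> = 2 * (m - L n)"
      using iR iRh[of n] iRR[of n] mh[of n] by (simp add: L_def m_def)
    finally show ?thesis by simp
  qed
  have "A \<longlonglongrightarrow> 0"
  proof (rule Lim_null_comparison)
    show "eventually (\<lambda>n. norm (A n) \<le> m - L n) sequentially"
      using wn0 by eventually_elim (rule bound)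
    show "(\<lambda>n. m - L n) \<longlonglongrightarrow> 0" using tendsto_diff[OF tendsto_const[of m] L] by simp
  qed
  then show ?thesis unfolding A_def e_def .
qed

text \<open>A density argument: indicators are compared with open supersets, sums follow by
  linearity, and limits pass because the L1 distance bounds the change of the integrals uniformly in
  \<open>n\<close>.\<close>

lemma Riemann_Lebesgue_complex:
  fixes f :: "complex \<Rightarrow> complex" and w :: "nat \<Rightarrow> complex"
  assumes "integrable lborel f" and w: "filterlim (\<lambda>n. norm (w n)) at_top sequentially"
  shows "(\<lambda>n. \<integral>x. f x * exp (\<i> * of_real (Re (w n * x))) \<partial>lborel) \<longlonglongrightarrow> 0"
  using assms(1)
proof (induction rule: integrable_induct)
  case (base A c)
  define I where "I B n = (\<integral>x. indicator B x * exp (\<i> * of_real (Re (w n * x))) \<partial>lborel)" for B n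
  have [measurable]: "A \<in> sets borel" using base by simp
  have "I A \<longlonglongrightarrow> 0"
  proof (rule LIMSEQ_I)
    fix r :: real assume r: "r > 0"
    obtain U where U: "open U" "A \<subseteq> U" "emeasure lborel (U - A) < ennreal (r/2)"
      using outer_regular_lborel[of A "r/2"] r by auto
    have [measurable]: "U \<in> sets borel" using U by simp
    have "emeasure lborel U = emeasure lborel A + emeasure lborel (U - A)"
      using U by (subst plus_emeasure) (auto intro!: arg_cong[where f="emeasure lborel"])
    then have Uf: "emeasure lborel U < \<infinity>"
      using base U by (auto simp: less_top[symmetric] top_unique)
    have UAf: "emeasure lborel (U - A) < \<infinity>" using U(3) by (auto intro: order.strict_trans)
    have iA: "integrable lborel (\<lambda>x. indicator A x :: complex)" and iU: "integrable lborel (\<lambda>x. indicator U x :: complex)"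
      using base Uf by (simp_all add: integrable_complex_indicator)
    obtain N where N: "\<And>n. n \<ge> N \<Longrightarrow> norm (I U n) < r/2"
      using LIMSEQ_D[OF Riemann_Lebesgue_open[OF U(1) Uf w], of "r/2"] r by (auto simp: I_def)
    have "norm (I A n - 0) < r" if "n \<ge> N" for n
    proof -
      have "I U n - I A n = (\<integral>x. indicator U x * exp (\<i> * of_real (Re (w n * x)))
          - indicator A x * exp (\<i> * of_real (Re (w n * x))) \<partial>lborel)"
        unfolding I_def by (intro Bochner_Integration.integral_diff[symmetric] integrable_mult_exp_Re iA iU)
      also have "\<dots> = (\<integral>x. indicator (U - A) x * exp (\<i> * of_real (Re (w n * x))) \<partial>lborel)"
        using U(2) by (intro Bochner_Integration.integral_cong refl) (auto simp: indicator_def)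
      also have "norm \<dots> \<le> (\<integral>x. indicator (U - A) x \<partial>lborel)"
      proof (rule Bochner_Integration.integral_norm_bound_integral)
        show "integrable lborel (\<lambda>x. indicator (U - A) x * exp (\<i> * of_real (Re (w n * x))))"
          using UAf by (intro integrable_mult_exp_Re integrable_complex_indicator) auto
        show "integrable lborel (\<lambda>x. indicator (U - A) x :: real)"
          using UAf by (intro integrable_real_indicator) auto
      qed (auto simp: norm_mult indicator_def)
      also have "\<dots> = measure lborel (U - A)" by simp
      also have "\<dots> < r/2"
        using U(3) r by (metis UAf emeasure_eq_ennreal_measure ennreal_less_iff infinity_ennreal_def less_irrefl measure_nonneg)
      finally have "norm (I U n - I A n) < r/2" .
      then show ?thesis using N[OF that] norm_triangle_ineq4[of "I U n" "I U n - I A n"] by simp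
    qed
    then show "\<exists>N. \<forall>n\<ge>N. norm (I A n - 0) < r" by blast
  qed
  then have "(\<lambda>n. c * I A n) \<longlonglongrightarrow> c * 0" by (intro tendsto_mult tendsto_const)
  moreover have "(\<integral>x. indicator A x *\<^sub>R c * exp (\<i> * of_real (Re (w n * x))) \<partial>lborel) = c * I A n" for n
  proof -
    have "(\<integral>x. indicator A x *\<^sub>R c * exp (\<i> * of_real (Re (w n * x))) \<partial>lborel)
      = (\<integral>x. c * (indicator A x * exp (\<i> * of_real (Re (w n * x)))) \<partial>lborel)"
      by (intro Bochner_Integration.integral_cong) (auto simp: indicator_def)
    then show ?thesis by (simp add: I_def)
  qed
  ultimately show ?case by simp
next
  case (add f g)
  have "(\<integral>x. (f x + g x) * exp (\<i> * of_real (Re (w n * x))) \<partial>lborel) =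
    (\<integral>x. f x * exp (\<i> * of_real (Re (w n * x))) \<partial>lborel) + (\<integral>x. g x * exp (\<i> * of_real (Re (w n * x))) \<partial>lborel)" for n
    unfolding distrib_right by (intro Bochner_Integration.integral_add integrable_mult_exp_Re add)
  with tendsto_add[OF add.IH] show ?case by simp
next
  case (lim f s)
  define I where "I f n = (\<integral>x. f x * exp (\<i> * of_real (Re (w n * x))) \<partial>lborel)" for f n
  have [measurable]: "f \<in> borel_measurable borel" "\<And>i. s i \<in> borel_measurable borel"
    using lim.hyps(1,4) by auto
  have "(\<lambda>i. \<integral>x. norm (f x - s i x) \<partial>lborel) \<longlonglongrightarrow> (\<integral>x. 0 \<partial>(lborel :: complex measure))"
  \<comment> \<open>The approximants are bounded by \<open>2 * norm (f x)\<close>, whence the factor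
    3 for the difference.\<close>
  proof (rule integral_dominated_convergence[where w="\<lambda>x. 3 * norm (f x)"])
    show "AE x in lborel. (\<lambda>i. norm (f x - s i x)) \<longlonglongrightarrow> 0"
    proof (intro AE_I2)
      fix x :: complex
      have "(\<lambda>i. norm (f x - s i x)) \<longlonglongrightarrow> norm (f x - f x)"
        using lim.hyps(2)[of x] by (intro tendsto_intros) auto
      then show "(\<lambda>i. norm (f x - s i x)) \<longlonglongrightarrow> 0" by simp
    qed
    show "AE x in lborel. norm (norm (f x - s i x)) \<le> 3 * norm (f x)" for i
    proof (intro AE_I2)
      fix x :: complex
      show "norm (norm (f x - s i x)) \<le> 3 * norm (f x)"
        using norm_triangle_ineq4[of "f x" "s i x"] lim.hyps(3)[of x i] by simp
    qed
  qed (use lim.hyps(4) in auto)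
  then have L1: "(\<lambda>i. \<integral>x. norm (f x - s i x) \<partial>lborel) \<longlonglongrightarrow> 0" by simp
  have diff: "norm (I f n - I (s i) n) \<le> (\<integral>x. norm (f x - s i x) \<partial>lborel)" for i n
  proof -
    have "I f n - I (s i) n = (\<integral>x. (f x - s i x) * exp (\<i> * of_real (Re (w n * x))) \<partial>lborel)"
      unfolding I_def left_diff_distrib
      by (intro Bochner_Integration.integral_diff[symmetric] integrable_mult_exp_Re lim.hyps)
    also have "norm \<dots> \<le> (\<integral>x. norm (f x - s i x) \<partial>lborel)"
      by (intro Bochner_Integration.integral_norm_bound_integral integrable_mult_exp_Re Bochner_Integration.integrable_diff
        integrable_norm lim.hyps) (auto simp: norm_mult)
    finally show ?thesis .
  qed
  have "I f \<longlonglongrightarrow> 0"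
  proof (rule LIMSEQ_I)
    fix r :: real assume r: "r > 0"
    obtain i where i: "(\<integral>x. norm (f x - s i x) \<partial>lborel) < r/2"
      using LIMSEQ_D[OF L1, of "r/2"] r by force
    obtain N where N: "\<And>n. n \<ge> N \<Longrightarrow> norm (I (s i) n) < r/2"
      using LIMSEQ_D[OF lim.IH[of i], of "r/2"] r by (auto simp: I_def)
    have "norm (I f n - 0) < r" if "n \<ge> N" for n
      using N[OF that] diff[of n i] i norm_triangle_ineq[of "I f n - I (s i) n" "I (s i) n"] by simp
    then show "\<exists>N. \<forall>n\<ge>N. norm (I f n - 0) < r" by blast
  qed
  then show ?case unfolding I_def .
qed

section \<open>The Fourier transform of the Bernoulli convolution\<close>

text \<open>The coordinates of \<open>sign_space\<close> are \<open>\<plusminus>1\<close> only almost surely; \<open>sign_of\<close> makes the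
  random series converge for every \<open>\<omega>\<close>.\<close>

definition sign_of :: "complex \<Rightarrow> complex" where
  "sign_of w = (if w = 1 then 1 else -1)"

definition sign_series :: "complex \<Rightarrow> (nat \<Rightarrow> complex) \<Rightarrow> complex" where
  "sign_series l \<omega> = (\<Sum>n. sign_of (\<omega> n) * l ^ n)"

lemma norm_sign_of [simp]: "norm (sign_of w) = 1"
  by (simp add: sign_of_def)

lemma summable_sign_series:
  assumes "norm l < 1"
  shows "summable (\<lambda>n. sign_of (\<omega> n) * l ^ n)"
proof (rule summable_norm_cancel)
  show "summable (\<lambda>n. norm (sign_of (\<omega> n) * l ^ n))"
    using assms by (simp add: norm_mult norm_power summable_geometric)
qed

lemma prob_space_sign_space: "prob_space sign_space"
  unfolding sign_space_def by (intro prob_space_PiM measure_pmf.prob_space_axioms)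

lemma space_sign_space [simp]: "space sign_space = UNIV"
  by (simp add: sign_space_def space_PiM PiE_def)

lemma measurable_sign_space_component [measurable]:
  "(\<lambda>\<omega>. \<omega> n) \<in> measurable sign_space (measure_pmf (pmf_of_set {-1, 1}))"
  unfolding sign_space_def by (rule measurable_component_singleton) simp

lemma measurable_sign_space_component_borel [measurable]:
  "(\<lambda>\<omega>. \<omega> n) \<in> borel_measurable sign_space"
  by (rule measurable_compose[OF measurable_sign_space_component]) simp

lemma measurable_sign_of [measurable]: "sign_of \<in> borel_measurable borel"
  unfolding sign_of_def by measurable

lemma measurable_sign_series [measurable]: "sign_series l \<in> borel_measurable sign_space"
  unfolding sign_series_def by measurable

lemma distr_sign_space_component:
  "distr sign_space (measure_pmf (pmf_of_set {-1, 1})) (\<lambda>\<omega>. \<omega> n) = measure_pmf (pmf_of_set {-1, 1})"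
  unfolding sign_space_def by (rule distr_PiM_component) (auto intro: measure_pmf.prob_space_axioms)

lemma bernoulli_conv_eq_distr_sign_series: "bernoulli_conv l = distr sign_space borel (sign_series l)"
proof -
  have "AE \<omega> in sign_space. \<omega> n \<in> {-1, 1}" for n
    unfolding sign_space_def
    by (rule AE_PiM_component) (auto simp: AE_measure_pmf_iff intro: measure_pmf.prob_space_axioms)
  then have "AE \<omega> in sign_space. \<forall>n. \<omega> n \<in> {-1, 1}" by (simp add: AE_all_countable)
  then have "AE \<omega> in sign_space. (\<Sum>n. \<omega> n * l ^ n) = sign_series l \<omega>"
  proof eventually_elim
    case (elim \<omega>)
    have "sign_of (\<omega> n) = \<omega> n" for n using elim[rule_format, of n] by (auto simp: sign_of_def)
    then show ?case by (simp add: sign_series_def)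
  qed
  then show ?thesis unfolding bernoulli_conv_def by (intro distr_cong_AE) simp_all
qed

lemma indep_vars_sign_space:
  "prob_space.indep_vars sign_space (\<lambda>_. measure_pmf (pmf_of_set {-1, 1})) (\<lambda>n \<omega>. \<omega> n) UNIV"
proof -
  interpret prob_space sign_space by (rule prob_space_sign_space)
  show ?thesis
  proof (subst indep_vars_iff_distr_eq_PiM)
    \<comment> \<open>The criterion restricts to the index set, which is everything here; the joint
      law is then the product measure by construction.\<close>
    have "(\<lambda>x :: nat \<Rightarrow> complex. \<lambda>i\<in>UNIV. x i) = (\<lambda>x. x)" by (simp add: restrict_def)
    then show "distr sign_space (\<Pi>\<^sub>M i\<in>UNIV. measure_pmf (pmf_of_set {-1, 1})) (\<lambda>x. \<lambda>i\<in>UNIV. x i)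
      = (\<Pi>\<^sub>M i\<in>UNIV. distr sign_space (measure_pmf (pmf_of_set {-1, 1})) (\<lambda>\<omega>. \<omega> i))"
      unfolding distr_sign_space_component by (simp add: distr_id2 flip: sign_space_def)
    show "random_variable (measure_pmf (pmf_of_set {-1, 1})) (\<lambda>\<omega>. \<omega> i)" for i
      by (rule measurable_sign_space_component)
  qed simp
qed

lemma integral_sign_space_component:
  fixes g :: "complex \<Rightarrow> complex"
  shows "(\<integral>\<omega>. g (\<omega> n) \<partial>sign_space) = (g 1 + g (-1)) / 2"
proof -
  have "(\<integral>\<omega>. g (\<omega> n) \<partial>sign_space)
      = (\<integral>x. g x \<partial>distr sign_space (measure_pmf (pmf_of_set {-1, 1})) (\<lambda>\<omega>. \<omega> n))"
    by (subst integral_distr[OF measurable_sign_space_component]) simp_all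
  also have "\<dots> = (\<integral>x. g x \<partial>measure_pmf (pmf_of_set {-1, 1}))"
    by (simp only: distr_sign_space_component)
  also have "\<dots> = (\<Sum>x\<in>{-1, 1}. g x) / 2"
    by (subst integral_measure_pmf[where A="{-1, 1}"]) (auto simp: pmf_of_set scaleR_conv_of_real)
  finally show ?thesis by simp
qed

text \<open>Independence turns the expectation into a product, and averaging the exponential over
  the two signs gives a cosine.\<close>

lemma fourier_sign_partial_sum:
  "(\<integral>\<omega>. exp (\<i> * of_real (Re (w * (\<Sum>k<n. sign_of (\<omega> k) * l ^ k)))) \<partial>sign_space)
     = (\<Prod>k<n. of_real (cos (Re (w * l ^ k))))"
proof -
  interpret prob_space sign_space by (rule prob_space_sign_space)
  define g where "g k x = exp (\<i> * of_real (Re (w * (sign_of x * l ^ k))))" for k x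
  have [measurable]: "g k \<in> borel_measurable borel" for k unfolding g_def by measurable
  have "indep_vars (\<lambda>_. borel) (\<lambda>k \<omega>. g k (\<omega> k)) UNIV"
    by (rule indep_vars_compose2[OF indep_vars_sign_space]) simp
  then have ind: "indep_vars (\<lambda>_. borel) (\<lambda>k \<omega>. g k (\<omega> k)) {..<n}"
    by (rule indep_vars_subset) simp
  have "(\<integral>\<omega>. exp (\<i> * of_real (Re (w * (\<Sum>k<n. sign_of (\<omega> k) * l ^ k)))) \<partial>sign_space)
      = (\<integral>\<omega>. (\<Prod>k<n. g k (\<omega> k)) \<partial>sign_space)"
    by (simp add: g_def sum_distrib_left Re_sum exp_sum[symmetric])
  also have "\<dots> = (\<Prod>k<n. \<integral>\<omega>. g k (\<omega> k) \<partial>sign_space)"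
    by (rule indep_vars_lebesgue_integral[OF _ ind])
      (auto intro!: integrable_const_bound[where B=1] simp: g_def)
  also have "\<dots> = (\<Prod>k<n. of_real (cos (Re (w * l ^ k))))"
  proof (rule prod.cong[OF refl])
    fix k
    have "(\<integral>\<omega>. g k (\<omega> k) \<partial>sign_space) = (exp (\<i> * of_real (Re (w * l ^ k))) + exp (- (\<i> * of_real (Re (w * l ^ k))))) / 2"
      unfolding integral_sign_space_component by (simp add: g_def sign_of_def right_diff_distrib)
    then show "(\<integral>\<omega>. g k (\<omega> k) \<partial>sign_space) = of_real (cos (Re (w * l ^ k)))"
      by (simp only: cos_exp_eq cos_of_real[symmetric])
  qed
  finally show ?thesis .
qed

text \<open>The partial sums converge pointwise and the exponentials have modulus 1, so dominated
  convergence carries the bound on finite products to the limit.\<close>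

lemma fourier_bernoulli_conv_lower_bound:
  assumes l: "norm l < 1" and c: "\<And>n. c \<le> (\<Prod>k<n. \<bar>cos (Re (w * l ^ k))\<bar>)"
  shows "c \<le> norm (\<integral>x. exp (\<i> * of_real (Re (w * x))) \<partial>bernoulli_conv l)"
proof -
  interpret prob_space sign_space by (rule prob_space_sign_space)
  define S where "S n \<omega> = (\<Sum>k<n. sign_of (\<omega> k) * l ^ k)" for n \<omega>
  have [measurable]: "S n \<in> borel_measurable sign_space" for n unfolding S_def by measurable
  have eq: "(\<integral>x. exp (\<i> * of_real (Re (w * x))) \<partial>bernoulli_conv l)
      = (\<integral>\<omega>. exp (\<i> * of_real (Re (w * sign_series l \<omega>))) \<partial>sign_space)"
    unfolding bernoulli_conv_eq_distr_sign_series by (rule integral_distr) measurable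
  have "(\<lambda>n. \<integral>\<omega>. exp (\<i> * of_real (Re (w * S n \<omega>))) \<partial>sign_space)
      \<longlonglongrightarrow> (\<integral>\<omega>. exp (\<i> * of_real (Re (w * sign_series l \<omega>))) \<partial>sign_space)"
  proof (rule integral_dominated_convergence[where w="\<lambda>_. 1"])
    show "AE \<omega> in sign_space. (\<lambda>n. exp (\<i> * of_real (Re (w * S n \<omega>)))) \<longlonglongrightarrow> exp (\<i> * of_real (Re (w * sign_series l \<omega>)))"
    proof (intro AE_I2)
      fix \<omega>
      have "(\<lambda>n. S n \<omega>) \<longlonglongrightarrow> sign_series l \<omega>"
        unfolding S_def sign_series_def by (rule summable_LIMSEQ[OF summable_sign_series[OF l]])
      then show "(\<lambda>n. exp (\<i> * of_real (Re (w * S n \<omega>)))) \<longlonglongrightarrow> exp (\<i> * of_real (Re (w * sign_series l \<omega>)))"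
        by (intro tendsto_intros)
    qed
  qed auto
  then have "(\<lambda>n. norm (\<integral>\<omega>. exp (\<i> * of_real (Re (w * S n \<omega>))) \<partial>sign_space))
      \<longlonglongrightarrow> norm (\<integral>x. exp (\<i> * of_real (Re (w * x))) \<partial>bernoulli_conv l)"
    unfolding eq by (rule tendsto_norm)
  moreover have "c \<le> norm (\<integral>\<omega>. exp (\<i> * of_real (Re (w * S n \<omega>))) \<partial>sign_space)" for n
    using c[of n] unfolding S_def fourier_sign_partial_sum by (simp add: prod_norm[symmetric])
  ultimately show ?thesis by (intro LIMSEQ_le_const) auto
qed

section \<open>The law of pure types\<close>

text \<open>The first \<open>n\<close> terms of the sign series sum to an element of Z[l].
  Invariance of \<open>B\<close> under Z[l] makes the event insensitive to the first
  \<open>n\<close> signs for every \<open>n\<close>, so Kolmogorov's law applies.\<close>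

lemma tail_set_zero_one:
  assumes l: "norm l < 1" and B: "B \<in> sets borel"
    and inv: "\<And>x f. x + poly (map_poly of_int (f :: int poly)) l \<in> B \<longleftrightarrow> x \<in> B"
  shows "measure (bernoulli_conv l) B = 0 \<or> measure (bernoulli_conv l) B = 1"
proof -
  interpret prob_space sign_space by (rule prob_space_sign_space)
  define p where "p = pmf_of_set {-1, 1::complex}"
  define A where "A i = sigma_sets (space sign_space) {(\<lambda>\<omega>. \<omega> i) -` S \<inter> space sign_space | S. S \<in> sets (measure_pmf p)}" for i :: nat
  define T where "T = sign_series l -` B \<inter> space sign_space"
  have "prob T = 0 \<or> prob T = 1"
  proof (rule kolmogorov_0_1_law[of A])
    show "sigma_algebra (space sign_space) (A i)" for i
      unfolding A_def by (rule sigma_algebra_sigma_sets) auto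
    show "indep_sets A UNIV"
      using indep_vars_sign_space unfolding indep_vars_def A_def p_def by simp
    show "T \<in> tail_events A"
      unfolding tail_events_def
    proof (intro INT_I)
      fix n :: nat
      \<comment> \<open>\<open>M\<close> records only the coordinates from \<open>n\<close> on, and
        the tail \<open>t\<close> of the series is measurable for it.\<close>
      define M where "M = sigma (space sign_space) (\<Union> (A ` {n..}))"
      have sp: "space M = UNIV" by (simp add: M_def)
      have sM: "sets M = sigma_sets (space sign_space) (\<Union> (A ` {n..}))"
        unfolding M_def by (rule sets_measure_of) simp
      define t where "t \<omega> = (\<Sum>k. sign_of (\<omega> (k + n)) * l ^ (k + n))" for \<omega>
      have comp: "(\<lambda>\<omega>. \<omega> (k + n)) \<in> measurable M (count_space UNIV)" for k
      proof (rule measurableI)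
        fix S :: "complex set"
        have "(\<lambda>\<omega>. \<omega> (k + n)) -` S \<inter> space sign_space \<in> A (k + n)"
          unfolding A_def by (rule sigma_sets.Basic) auto
        then show "(\<lambda>\<omega>. \<omega> (k + n)) -` S \<inter> space M \<in> sets M"
          unfolding sM by (intro sigma_sets.Basic) (auto simp: sp)
      qed simp
      have [measurable]: "(\<lambda>\<omega>. sign_of (\<omega> (k + n))) \<in> borel_measurable M" for k
        by (rule measurable_compose[OF comp]) simp
      have tm: "t \<in> borel_measurable M" unfolding t_def by measurable
      have "sign_series l \<omega> \<in> B \<longleftrightarrow> t \<omega> \<in> B" for \<omega>
      proof -
        have "sign_series l \<omega> = t \<omega> + (\<Sum>k<n. sign_of (\<omega> k) * l ^ k)"
          unfolding sign_series_def t_def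
          by (rule suminf_split_initial_segment[OF summable_sign_series[OF l]])
        also have "(\<Sum>k<n. sign_of (\<omega> k) * l ^ k)
            = poly (map_poly of_int (\<Sum>k<n. monom (if \<omega> k = 1 then 1 else -1) k)) l"
          by (simp add: of_int_poly_hom.hom_sum poly_sum map_poly_monom poly_monom sign_of_def
            if_distrib[of "\<lambda>x. x * _"] if_distrib[of of_int] cong: if_cong)
        finally show ?thesis using inv by simp
      qed
      then have "T = t -` B \<inter> space M" by (auto simp: T_def sp)
      also have "\<dots> \<in> sets M" using tm B by (rule measurable_sets)
      finally show "T \<in> sigma_sets (space sign_space) (\<Union> (A ` {n..}))" unfolding sM .
    qed
  qed
  moreover have "measure (bernoulli_conv l) B = prob T"
    unfolding bernoulli_conv_eq_distr_sign_series T_def using B by (intro measure_distr) auto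
  ultimately show ?thesis by simp
qed

text \<open>A Lebesgue-null \<open>A\<close> is enlarged to a null set \<open>B\<close> that obeys
  the zero-one law. Measure 1 would make \<open>B\<close> a witness of singularity, so
  \<open>B\<close>, and with it \<open>A\<close>, has measure 0.\<close>

lemma bernoulli_conv_pure_type:
  assumes l: "norm l < 1" and ns: "\<not> singular_wrt_lebesgue (bernoulli_conv l)"
  shows "absolutely_continuous lborel (bernoulli_conv l)"
proof -
  interpret sgn: prob_space sign_space by (rule prob_space_sign_space)
  interpret prob_space "bernoulli_conv l"
    unfolding bernoulli_conv_eq_distr_sign_series by (rule sgn.prob_space_distr) simp
  have sets_b: "sets (bernoulli_conv l) = sets borel" by (simp add: bernoulli_conv_def)
  have space_b: "space (bernoulli_conv l) = UNIV" by (simp add: bernoulli_conv_def)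
  show ?thesis unfolding absolutely_continuous_def
  proof
    fix A :: "complex set" assume A: "A \<in> null_sets lborel"
    then have [measurable]: "A \<in> sets borel" by auto
    define g where "g f = poly (map_poly of_int (f :: int poly)) l" for f
    have g_add: "g (f + f') = g f + g f'" for f f'
      by (simp add: g_def of_int_poly_hom.hom_add)
    have g_diff: "g (f - f') = g f - g f'" for f f'
      by (simp add: g_def of_int_poly_hom.hom_minus)
    \<comment> \<open>Saturating \<open>A\<close> under the countable group \<open>\<int>[l]\<close> keeps it null and turns it into a tail event.\<close>
    define B where "B = (\<Union>f. (+) (g f) -` A)"
    \<comment> \<open>Integer polynomials are coded by coefficient lists; countability keeps the
      union of translates null.\<close>
    have "range (Poly :: int list \<Rightarrow> int poly) = UNIV"
      by (metis Poly_coeffs surjI)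
    then have cnt: "countable (UNIV :: int poly set)"
      by (metis countable_image countableI_type)
    have null: "(+) (g f) -` A \<in> null_sets lborel" for f
    proof -
      have "emeasure lborel A = emeasure (distr lborel borel ((+) (g f))) A" by (simp add: lborel_distr_plus)
      also have "\<dots> = emeasure lborel ((+) (g f) -` A)" by (subst emeasure_distr) auto
      finally show ?thesis using A by (auto simp: null_sets_def intro!: measurable_sets_borel[of _ borel])
    qed
    have B0: "B \<in> null_sets lborel" unfolding B_def by (rule null_sets_UN'[OF cnt null])
    then have [measurable]: "B \<in> sets borel" by auto
    have inv: "x + g f \<in> B \<longleftrightarrow> x \<in> B" for x f
    proof
      assume "x + g f \<in> B"
      then obtain f' where "g f' + (x + g f) \<in> A" by (auto simp: B_def)
      then have "g (f' + f) + x \<in> A" by (simp add: g_add algebra_simps)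
      then show "x \<in> B" by (auto simp: B_def)
    next
      assume "x \<in> B"
      then obtain f' where "g f' + x \<in> A" by (auto simp: B_def)
      then have "g (f' - f) + (x + g f) \<in> A" by (simp add: g_diff algebra_simps)
      then show "x + g f \<in> B" by (auto simp: B_def)
    qed
    have AB: "A \<subseteq> B"
    proof
      fix x assume "x \<in> A"
      then have "g 0 + x \<in> A" by (simp add: g_def)
      then show "x \<in> B" by (auto simp: B_def)
    qed
    have "prob B \<noteq> 1"
    proof
      assume "prob B = 1"
      then have "prob (space (bernoulli_conv l) - B) = 0"
        by (subst prob_compl) (auto simp: sets_b)
      then have "emeasure (bernoulli_conv l) (UNIV - B) = 0"
        by (simp add: emeasure_eq_measure space_b)
      then have "singular_wrt_lebesgue (bernoulli_conv l)"
        unfolding singular_wrt_lebesgue_def using B0 by (intro bexI[of _ B]) auto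
      with ns show False by contradiction
    qed
    then have "prob B = 0"
      using tail_set_zero_one[OF l, of B] inv by (auto simp: g_def)
    then have "prob A = 0"
      using finite_measure_mono[OF AB] by (simp add: sets_b measure_le_0_iff)
    then show "A \<in> null_sets (bernoulli_conv l)"
      by (simp add: null_sets_def sets_b emeasure_eq_measure)
  qed
qed

section \<open>Fourier decay and the contradiction\<close>

text \<open>The Radon-Nikodym density is Lebesgue integrable because \<mu> is finite, so the
  Riemann-Lebesgue lemma applies to it.\<close>

lemma fourier_absolutely_continuous_tendsto_0:
  fixes w :: "nat \<Rightarrow> complex"
  assumes "finite_measure \<mu>" "absolutely_continuous lborel \<mu>" "sets \<mu> = sets borel"
    and w: "filterlim (\<lambda>n. norm (w n)) at_top sequentially"
  shows "(\<lambda>n. \<integral>x. exp (\<i> * of_real (Re (w n * x))) \<partial>\<mu>) \<longlonglongrightarrow> 0"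
proof -
  interpret finite_measure \<mu> by fact
  have s: "sets \<mu> = sets lborel" using assms(3) by simp
  obtain D :: "complex \<Rightarrow> real" where D [measurable]: "D \<in> borel_measurable borel" and
    RN: "AE x in lborel. RN_deriv lborel \<mu> x = ennreal (D x)" and D0: "\<And>x. 0 \<le> D x"
    by (rule sigma_finite_measure.real_RN_deriv[OF sigma_finite_lborel assms(1,2) s]) auto
  have "density lborel (RN_deriv lborel \<mu>) = \<mu>"
    by (rule sigma_finite_measure.density_RN_deriv[OF sigma_finite_lborel assms(2) s])
  moreover have "density lborel (RN_deriv lborel \<mu>) = density lborel (\<lambda>x. ennreal (D x))"
    using RN by (intro density_cong) auto
  ultimately have \<mu>: "\<mu> = density lborel (\<lambda>x. ennreal (D x))" by simp
  have "integrable \<mu> (\<lambda>x. 1 :: real)" by simp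
  then have "integrable lborel D" unfolding \<mu> by (subst (asm) integrable_density) (auto simp: D0)
  then have iD: "integrable lborel (\<lambda>x. complex_of_real (D x))" by simp
  have "(\<integral>x. exp (\<i> * of_real (Re (w n * x))) \<partial>\<mu>)
      = (\<integral>x. complex_of_real (D x) * exp (\<i> * of_real (Re (w n * x))) \<partial>lborel)" for n
    unfolding \<mu> by (subst integral_density) (auto simp: D0 scaleR_conv_of_real)
  with Riemann_Lebesgue_complex[OF iD w] show ?thesis by simp
qed

theorem mainTheorem7:
  fixes \<theta> :: complex
  assumes "complex_pisot \<theta>" and "norm \<theta> < sqrt 2"
  shows "singular_wrt_lebesgue (bernoulli_conv (1 / \<theta>))"
proof (rule ccontr)
  assume ns: "\<not> singular_wrt_lebesgue (bernoulli_conv (1 / \<theta>))"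
  have n1: "norm \<theta> > 1" using assms(1) by (simp add: complex_pisot_def)
  then have l: "norm (1 / \<theta>) < 1" by (auto simp: norm_divide divide_less_eq_1)
  \<comment> \<open>These frequencies produce exactly the cosine products bounded below by
    \<open>c\<close>, while their moduli tend to infinity.\<close>
  define w where "w N = of_real (2 * pi) * \<theta> ^ N" for N
  obtain c where c: "c > 0" "\<And>N n. c \<le> (\<Prod>k<n. \<bar>cos (Re (w N * (1 / \<theta>) ^ k))\<bar>)"
    using complex_pisot_cos_prod_lower_bound[OF assms] unfolding w_def by metis
  interpret sgn: prob_space sign_space by (rule prob_space_sign_space)
  interpret prob_space "bernoulli_conv (1 / \<theta>)"
    unfolding bernoulli_conv_eq_distr_sign_series by (rule sgn.prob_space_distr) simp
  have w: "filterlim (\<lambda>N. norm (w N)) at_top sequentially"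
    unfolding w_def using n1
    by (intro filterlim_at_infinity_imp_norm_at_top filterlim_realpow_sequentially_gt1
      tendsto_mult_filterlim_at_infinity[OF tendsto_const]) auto
  have "(\<lambda>N. \<integral>x. exp (\<i> * of_real (Re (w N * x))) \<partial>bernoulli_conv (1 / \<theta>)) \<longlonglongrightarrow> 0"
    by (rule fourier_absolutely_continuous_tendsto_0[OF finite_measure_axioms bernoulli_conv_pure_type[OF l ns] _ w])
      (simp add: bernoulli_conv_def)
  from tendsto_norm[OF this]
  have "(\<lambda>N. norm (\<integral>x. exp (\<i> * of_real (Re (w N * x))) \<partial>bernoulli_conv (1 / \<theta>))) \<longlonglongrightarrow> 0" by simp
  moreover have "c \<le> norm (\<integral>x. exp (\<i> * of_real (Re (w N * x))) \<partial>bernoulli_conv (1 / \<theta>))" for N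
    by (rule fourier_bernoulli_conv_lower_bound[OF l c(2)])
  ultimately have "c \<le> 0" by (intro LIMSEQ_le_const) auto
  with c(1) show False by simp
qed

end
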